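(* Fix an integer $\omega\ge 5$. Then every (finite, simple) claw-free graph $G$ with clique number $\omega(G)=\omega$ satisfies $\chi(G^2)\le \max\{\chi'_s(\omega),\,2\omega(\omega-1)-3\}$.
   Context: A graph is claw-free if it contains no induced subgraph isomorphic to $K_{1,3}$. The square $G^2$ of a graph $G$ is the graph on $V(G)$ in which two distinct vertices are adjacent iff they are at distance at most $2$ in $G$. $\chi$ denotes the chromatic number. For a positive integer $d$, $\chi'_s(d)$ denotes the supremum of $\chi(L^2)$ over all line graphs $L$ of simple graphs of maximum degree $d$. *)

theory Defs
  imports "Graph_Theory.Graph_Theory" "HOL-Library.Extended_Nat"
begin

text \<open>
  Finite simple graphs are the symmetric, irreflexive arc relations of \<^locale>\<open>pair_graph\<close>:
  an edge \<open>uv\<close> is represented by the two arcs \<open>(u, v)\<close> and \<open>(v, u)\<close>, so that the degree of a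
  vertex is its \<^const>\<open>out_degree\<close>.
\<close>

definition claw_free :: "'a pair_pre_digraph \<Rightarrow> bool" where
  "claw_free G \<longleftrightarrow>
     \<not> (\<exists>H :: 'a pair_pre_digraph. induced_subgraph (with_proj H) (with_proj G) \<and>
          K\<^bsub>1,3\<^esub> (with_proj H))"

definition clique_number :: "'a pair_pre_digraph \<Rightarrow> nat" where
  "clique_number G =
     Max {n. \<exists>H :: 'a pair_pre_digraph. subgraph (with_proj H) (with_proj G) \<and>
               K\<^bsub>n\<^esub> (with_proj H)}"

text \<open>The unweighted distance; it is \<open>\<infinity>\<close> if no walk joins the two vertices.\<close>

definition graph_dist :: "'a pair_pre_digraph \<Rightarrow> 'a \<Rightarrow> 'a \<Rightarrow> ereal" where
  "graph_dist G u v = wf_digraph.\<mu> (with_proj G) (\<lambda>_. 1) u v"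

definition graph_square :: "'a pair_pre_digraph \<Rightarrow> 'a pair_pre_digraph" where
  "graph_square G =
     \<lparr> pverts = pverts G,
       parcs = {(u, v). u \<in> pverts G \<and> v \<in> pverts G \<and> u \<noteq> v \<and> graph_dist G u v \<le> 2} \<rparr>"

definition proper_colouring :: "'a pair_pre_digraph \<Rightarrow> nat \<Rightarrow> ('a \<Rightarrow> nat) \<Rightarrow> bool" where
  "proper_colouring G k c \<longleftrightarrow>
     c ` pverts G \<subseteq> {..<k} \<and> (\<forall>(u, v) \<in> parcs G. c u \<noteq> c v)"

definition chromatic_number :: "'a pair_pre_digraph \<Rightarrow> nat" where
  "chromatic_number G = (LEAST k. \<exists>c. proper_colouring G k c)"

definition line_graph :: "'a pair_pre_digraph \<Rightarrow> 'a set pair_pre_digraph" where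
  "line_graph G =
     (let E = {{u, v} | u v. (u, v) \<in> parcs G}
      in \<lparr> pverts = E, parcs = {(e, f). e \<in> E \<and> f \<in> E \<and> e \<noteq> f \<and> e \<inter> f \<noteq> {}} \<rparr>)"

text \<open>The inserted \<open>0\<close> only matters for the graph without vertices.\<close>

definition max_degree :: "'a pair_pre_digraph \<Rightarrow> nat" where
  "max_degree G = Max (insert 0 (out_degree (with_proj G) ` pverts G))"

text \<open>
  \<open>\<chi>'\<^sub>s(d)\<close>. Every finite graph has an isomorphic copy with vertices in \<^typ>\<open>nat\<close>, so nothing is lost
  by fixing this vertex type; the supremum is taken in \<^typ>\<open>enat\<close>, where it always exists.
\<close>

definition strong_chromatic_index_sup :: "nat \<Rightarrow> enat" where
  "strong_chromatic_index_sup d =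
     Sup {enat (chromatic_number (graph_square (line_graph H))) |
            H :: nat pair_pre_digraph. pair_graph H \<and> max_degree H = d}"

end

theory Submission
  imports Defs
begin

text \<open>
  Call a vertex \<open>v\<close> split if its closed neighbourhood is the union of two \<open>\<omega>\<close>-cliques that share
  only \<open>v\<close> and have no further edges between them. A vertex that is not split has degree at most
  \<open>2\<omega>(\<omega> - 1) - 4\<close> in the square, so it suffices to colour the split vertices and extend greedily.
  By claw-freeness every vertex lies in at most two of the cliques of split vertices. Hence the graph
  \<open>H\<close> whose vertices are these cliques, with intersecting ones adjacent, has maximum degree at most
  \<open>\<omega>\<close>. Split vertices correspond injectively to edges of \<open>H\<close>, and those at distance at most two
  go to edges at distance at most two in the line graph of \<open>H\<close>.
\<close>

section \<open>Distance at most two\<close>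

lemma graph_squareD:
  assumes "pair_graph G" "(u, v) \<in> parcs (graph_square G)"
  shows "u \<noteq> v" "(u, v) \<in> parcs G \<union> parcs G O parcs G"
proof -
  interpret pair_graph G by fact
  have uv: "u \<noteq> v" "\<mu> (\<lambda>_. 1) u v \<le> 2"
    using assms(2) by (auto simp: graph_square_def graph_dist_def)
  show "u \<noteq> v" by fact
  \<comment> \<open>A strict bound lets the infimum yield an actual walk. Its cost is its length, so
    cost below 3 means at most two arcs.\<close>
  have "\<mu> (\<lambda>_. 1) u v < ereal 3"
    using uv(2) by (rule le_less_trans) simp
  then obtain p where p: "awalk u p v" "awalk_cost (\<lambda>_. 1) p < 3"
    unfolding \<mu>_def by (auto simp: INF_less_iff)
  have "awalk_cost (\<lambda>_. 1) p = length p"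
    by (induction p) auto
  with p(2) have "length p < 3" by simp
  then consider "p = []" | e where "p = [e]" | e f where "p = [e, f]"
    by (cases p; cases "tl p"; cases "tl (tl p)") auto
  then show "(u, v) \<in> parcs G \<union> parcs G O parcs G"
    using p(1) uv(1) by cases (auto simp: awalk_def)
qed

text \<open>Stated for \<open>pair_wf_digraph\<close> because it is applied to a line graph, of
  which only well-formedness is established.\<close>

lemma graph_squareI:
  assumes "pair_wf_digraph G" "u \<noteq> v" "(u, v) \<in> parcs G \<union> parcs G O parcs G"
  shows "(u, v) \<in> parcs (graph_square G)"
proof -
  interpret pair_wf_digraph G by fact
  have uv: "u \<in> pverts G" "v \<in> pverts G"
    using assms(3) by (auto dest: in_arcsD1 in_arcsD2)
  obtain p where "awalk u p v" "length p \<le> 2"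
  proof (cases "(u, v) \<in> parcs G")
    case True
    then show thesis using uv by (intro that[of "[(u, v)]"]) (auto simp: awalk_def)
  next
    case False
    then obtain w where "(u, w) \<in> parcs G" "(w, v) \<in> parcs G" using assms(3) by auto
    then show thesis using uv by (intro that[of "[(u, w), (w, v)]"]) (auto simp: awalk_def)
  qed
  moreover have "awalk_cost (\<lambda>_. 1) p = length p"
    by (induction p) auto
  ultimately have "\<mu> (\<lambda>_. 1) u v \<le> 2"
    using min_cost_le_walk_cost[of u p v "\<lambda>_. 1"]
    by (metis ereal_less_eq(3) numeral_eq_ereal of_nat_le_iff of_nat_numeral order_trans)
  then show ?thesis
    using uv assms(2) by (simp add: graph_square_def graph_dist_def)
qed

section \<open>Colourings\<close>

lemma chromatic_number_le: "proper_colouring G k c \<Longrightarrow> chromatic_number G \<le> k"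
  unfolding chromatic_number_def by (rule Least_le) blast

text \<open>An injective numbering of the vertices is a proper colouring, so \<open>LEAST\<close>
  ranges over a nonempty set.\<close>

lemma chromatic_number_attained:
  assumes "finite (pverts G)" "parcs G \<subseteq> pverts G \<times> pverts G" "irrefl (parcs G)"
  obtains c where "proper_colouring G (chromatic_number G) c"
proof -
  obtain f and n :: nat where f: "f ` pverts G = {i. i < n}" "inj_on f (pverts G)"
    using finite_imp_inj_to_nat_seg[OF assms(1)] by auto
  have "proper_colouring G n f"
    using f assms(2,3) by (fastforce simp: proper_colouring_def inj_on_def irrefl_def)
  then have "\<exists>c. proper_colouring G (chromatic_number G) c"
    unfolding chromatic_number_def
    using LeastI_ex[of "\<lambda>k. \<exists>c. proper_colouring G k c"] by blast
  then show thesis using that by blast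
qed

text \<open>The vertices of \<open>B\<close> are coloured one by one; fewer than \<open>k\<close>
  neighbours always leave a colour free. Vertices outside \<open>B\<close> may have any degree:
  \<open>A\<close> will be the set of split vertices.\<close>

lemma greedy_colouring_extension:
  assumes "finite B" "sym R" "irrefl R"
    and "\<And>b. b \<in> B \<Longrightarrow> finite (R `` {b}) \<and> card (R `` {b}) < k"
    and "c ` A \<subseteq> {..<k}" "\<forall>x\<in>A. \<forall>y\<in>A. (x, y) \<in> R \<longrightarrow> c x \<noteq> c y"
  shows "\<exists>c'. c' ` (A \<union> B) \<subseteq> {..<k} \<and>
               (\<forall>x\<in>A \<union> B. \<forall>y\<in>A \<union> B. (x, y) \<in> R \<longrightarrow> c' x \<noteq> c' y)"
  using assms(1,4)
proof (induction B rule: finite_induct)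
  case empty
  then show ?case using assms(5,6) by auto
next
  case (insert b B)
  then obtain c' where c': "c' ` (A \<union> B) \<subseteq> {..<k}"
      "\<forall>x\<in>A \<union> B. \<forall>y\<in>A \<union> B. (x, y) \<in> R \<longrightarrow> c' x \<noteq> c' y"
    by auto
  show ?case
  proof (cases "b \<in> A")
    case True
    then show ?thesis using c' by (intro exI[of _ c']) (auto simp: insert_absorb)
  next
    case False
    have fin: "finite (R `` {b})" and less: "card (R `` {b}) < k"
      using insert.prems by auto
    \<comment> \<open>\<open>c'\<close> is total, so all neighbours of \<open>b\<close> can be
      avoided at once, including those not yet coloured.\<close>
    have "card (c' ` (R `` {b})) < card {..<k}"
      using card_image_le[OF fin, of c'] less by simp
    then obtain i where i: "i < k" "i \<notin> c' ` (R `` {b})"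
      using fin by (metis card_mono finite_imageI lessThan_iff not_le subsetI)
    have "(c'(b := i)) x \<noteq> (c'(b := i)) y"
      if "x \<in> A \<union> insert b B" "y \<in> A \<union> insert b B" "(x, y) \<in> R" for x y
    proof -
      have "x \<noteq> y" using that(3) assms(3) by (auto simp: irrefl_def)
      moreover have "(y, x) \<in> R" using that(3) assms(2) by (auto dest: symD)
      ultimately show ?thesis using that i c'(2) by auto
    qed
    moreover have "(c'(b := i)) ` (A \<union> insert b B) \<subseteq> {..<k}"
      using c'(1) i(1) by auto
    ultimately show ?thesis by blast
  qed
qed

text \<open>
  A disjoint star with \<open>d\<close> leaves raises the maximum degree to exactly \<open>d\<close>, as the
  definition of \<open>\<chi>'\<^sub>s(d)\<close> demands.
\<close>

lemma strong_edge_colouring: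
  fixes R :: "'b rel"
  assumes "finite R" "sym R" "irrefl R" "\<And>x. card (R `` {x}) \<le> d"
  obtains k c where "enat k \<le> strong_chromatic_index_sup d"
    and "\<And>x y. (x, y) \<in> R \<Longrightarrow> c {x, y} < (k :: nat)"
    and "\<And>x y x' y' a b. (x, y) \<in> R \<Longrightarrow> (x', y') \<in> R \<Longrightarrow> (a, b) \<in> R \<Longrightarrow> {x, y} \<noteq> {x', y'} \<Longrightarrow>
           {x, y} \<inter> {a, b} \<noteq> {} \<Longrightarrow> {a, b} \<inter> {x', y'} \<noteq> {} \<Longrightarrow> c {x, y} \<noteq> c {x', y'}"
proof -
  have finF: "finite (Field R)" using assms(1) by (simp add: finite_Field)
  obtain f and n :: nat where f: "f ` Field R = {i. i < n}" "inj_on f (Field R)"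
    using finite_imp_inj_to_nat_seg[OF finF] by auto
  \<comment> \<open>The numbers below \<open>n\<close> carry the copy \<open>S\<close> of
    \<open>R\<close>; \<open>n\<close> is the centre of the star \<open>T\<close>, and the next
    \<open>d\<close> numbers are its leaves.\<close>
  define S where "S = map_prod f f ` R"
  define T where "T = {n} \<times> {n<..n + d}"
  define H where "H = \<lparr>pverts = {..n + d}, parcs = S \<union> T \<union> T\<inverse>\<rparr>"
  have fR: "f x < n \<and> f y < n" if "(x, y) \<in> R" for x y
    using that f(1) by (auto simp: Field_def)
  have S_less: "x < n \<and> y < n" if "(x, y) \<in> S" for x y
    using that fR by (auto simp: S_def)
  have symS: "(y, x) \<in> S" if "(x, y) \<in> S" for x y
    using that assms(2) by (force simp: S_def dest: symD)
  have irrS: "(x, x) \<notin> S" for x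
    using assms(3) f(2) by (force simp: S_def irrefl_def inj_on_def Field_def)
  have finH: "finite (parcs H)"
    using assms(1) by (simp add: H_def S_def T_def)
  interpret H: pair_graph H
  proof
    show "finite (pverts H)" by (simp add: H_def)
    show "finite (parcs H)" by (fact finH)
    show "symmetric H"
      using symS by (auto simp: symmetric_def H_def intro!: symI)
    fix e assume e: "e \<in> parcs H"
    obtain x y where xy: "e = (x, y)" by (cases e)
    show "fst e \<in> pverts H" "snd e \<in> pverts H"
      using e S_less[of x y] by (auto simp: xy H_def T_def)
    show "fst e \<noteq> snd e"
      using e irrS by (auto simp: xy H_def T_def)
  qed
  have deg: "out_degree (with_proj H) v = card (parcs H `` {v})" for v
  proof -
    have "out_arcs (with_proj H) v = Pair v ` (parcs H `` {v})"
      by (auto simp: out_arcs_def)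
    then show ?thesis by (simp add: out_degree_def card_image inj_on_def)
  qed
  have deg_n: "card (parcs H `` {n}) = d"
  proof -
    have "parcs H `` {n} = {n<..n + d}"
      using S_less by (auto simp: H_def T_def)
    then show ?thesis by simp
  qed
  have deg_le: "card (parcs H `` {v}) \<le> d" for v
  proof -
    consider "v < n" | "v = n" | "v > n" by linarith
    then show ?thesis
    proof cases
      case 1
      then obtain x where x: "x \<in> Field R" "v = f x" using f(1) by auto
      have "parcs H `` {v} \<subseteq> f ` (R `` {x})"
      proof
        fix y assume "y \<in> parcs H `` {v}"
        then have "(v, y) \<in> S" using 1 by (auto simp: H_def T_def)
        then obtain a b where "(a, b) \<in> R" "f a = v" "f b = y" by (auto simp: S_def)
        moreover from this have "a = x"
          using x f(2) by (auto simp: inj_on_def Field_def)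
        ultimately show "y \<in> f ` (R `` {x})" by auto
      qed
      moreover have fin: "finite (R `` {x})" using assms(1) by auto
      ultimately have "card (parcs H `` {v}) \<le> card (R `` {x})"
        by (meson card_image_le card_mono finite_imageI le_trans)
      then show ?thesis using assms(4)[of x] by linarith
    next
      case 2
      then show ?thesis using deg_n by simp
    next
      case 3
      \<comment> \<open>A leaf has degree one, and its existence forces \<open>d \<ge> 1\<close>;
        numbers beyond the leaves have no arcs.\<close>
      then have "parcs H `` {v} \<subseteq> (if v \<le> n + d then {n} else {})"
        using S_less by (fastforce simp: H_def T_def)
      then have "card (parcs H `` {v}) \<le> card (if v \<le> n + d then {n} else {})"
        by (intro card_mono) auto
      then show ?thesis using 3 by (auto split: if_splits)
    qed
  qed
  have "max_degree H = d"
    unfolding max_degree_def deg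
  proof (rule Max_eqI)
    show "d \<in> insert 0 ((\<lambda>v. card (parcs H `` {v})) ` pverts H)"
      using deg_n by (auto simp: H_def intro!: image_eqI[of _ _ n])
  qed (use deg_le in \<open>auto simp: H_def\<close>)
  define L where "L = line_graph H"
  have L: "pverts L = {{u, v} | u v. (u, v) \<in> parcs H}"
    "parcs L = {(e, f). e \<in> pverts L \<and> f \<in> pverts L \<and> e \<noteq> f \<and> e \<inter> f \<noteq> {}}"
    by (auto simp: L_def line_graph_def Let_def)
  have wfL: "pair_wf_digraph L"
    by unfold_locales (auto simp: L)
  define k where "k = chromatic_number (graph_square L)"
  have "finite (pverts L)"
  proof -
    have "pverts L = (\<lambda>(u, v). {u, v}) ` parcs H" by (auto simp: L)
    then show ?thesis using finH by simp
  qed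
  then have "finite (pverts (graph_square L))" by (simp add: graph_square_def)
  then obtain c where c: "proper_colouring (graph_square L) k c"
    unfolding k_def
    by (rule chromatic_number_attained) (auto simp: graph_square_def irrefl_def)
  have edge: "f ` {x, y} \<in> pverts L" if "(x, y) \<in> R" for x y
    using that by (force simp: L H_def S_def)
  show thesis
  proof (rule that[of k "\<lambda>e. c (f ` e)"])
    show "enat k \<le> strong_chromatic_index_sup d"
      unfolding strong_chromatic_index_sup_def k_def L_def
      using H.pair_graph \<open>max_degree H = d\<close> by (intro Sup_upper) auto
  next
    fix x y assume "(x, y) \<in> R"
    then show "c (f ` {x, y}) < k"
      using c edge by (auto simp: proper_colouring_def graph_square_def)
  next
    fix x y x' y' a b
    assume R: "(x, y) \<in> R" "(x', y') \<in> R" "(a, b) \<in> R" and ne: "{x, y} \<noteq> {x', y'}"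
      and meet: "{x, y} \<inter> {a, b} \<noteq> {}" "{a, b} \<inter> {x', y'} \<noteq> {}"
    have "{x, y} \<subseteq> Field R" "{x', y'} \<subseteq> Field R" using R by (auto simp: Field_def)
    then have ne': "f ` {x, y} \<noteq> f ` {x', y'}"
      using ne f(2) by (simp only: inj_on_image_eq_iff not_False_eq_True)
    have meet': "f ` {x, y} \<inter> f ` {a, b} \<noteq> {}" "f ` {a, b} \<inter> f ` {x', y'} \<noteq> {}"
      using meet by auto
    \<comment> \<open>The linking edge \<open>{a, b}\<close> may coincide with one of the other two,
      so each step is an arc of \<open>L\<close> or an equality.\<close>
    have arc: "(e, e') \<in> parcs L \<union> Id" if "e \<in> pverts L" "e' \<in> pverts L" "e \<inter> e' \<noteq> {}" for e e'
      using that unfolding L(2) by simp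
    have step: "(f ` {x, y}, f ` {a, b}) \<in> parcs L \<union> Id" "(f ` {a, b}, f ` {x', y'}) \<in> parcs L \<union> Id"
      using R meet' by (simp_all only: arc edge not_False_eq_True)
    have trans: "(e, e'') \<in> parcs L \<union> parcs L O parcs L"
      if "(e, e') \<in> parcs L \<union> Id" "(e', e'') \<in> parcs L \<union> Id" "e \<noteq> e''" for e e' e''
      using that by auto
    have "(f ` {x, y}, f ` {x', y'}) \<in> parcs L \<union> parcs L O parcs L"
      using step ne' by (rule trans)
    then have "(f ` {x, y}, f ` {x', y'}) \<in> parcs (graph_square L)"
      using graph_squareI[OF wfL ne'] by blast
    then show "c (f ` {x, y}) \<noteq> c (f ` {x', y'})"
      using c by (auto simp: proper_colouring_def)
  qed
qed

section \<open>Claw-free graphs with bounded clique number\<close>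

definition clique :: "'a rel \<Rightarrow> 'a set \<Rightarrow> bool" where
  "clique E C \<longleftrightarrow> (\<forall>x\<in>C. \<forall>y\<in>C. x \<noteq> y \<longrightarrow> (x, y) \<in> E)"

text \<open>The classical bound for the Ramsey number R(3, k + 1), doubled to avoid division. Remove
  a vertex \<open>u\<close>: its non-neighbours \<open>A\<close> form a clique, since a non-adjacent
  pair in \<open>A\<close> would be independent together with \<open>u\<close>; cliques among its
  neighbours \<open>B\<close> can be enlarged by \<open>u\<close>, so induction applies to
  \<open>B\<close>.\<close>

lemma ramsey_three_bound:
  assumes "finite X" "sym E"
    and "\<And>a b c. {a, b, c} \<subseteq> X \<Longrightarrow> distinct [a, b, c] \<Longrightarrow> (a, b) \<in> E \<or> (a, c) \<in> E \<or> (b, c) \<in> E"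
    and "\<And>C. C \<subseteq> X \<Longrightarrow> clique E C \<Longrightarrow> card C \<le> k"
  shows "2 * card X \<le> k * (k + 3)"
  using assms
proof (induction k arbitrary: X)
  case 0
  have "X = {}"
  proof (rule ccontr)
    assume "X \<noteq> {}"
    then obtain x where "{x} \<subseteq> X" by auto
    then show False using "0.prems"(4)[of "{x}"] by (simp add: clique_def)
  qed
  then show ?case by simp
next
  case (Suc k)
  note sub = Suc.prems(3) and cl = Suc.prems(4) and fin = Suc.prems(1)
  show ?case
  proof (cases "X = {}")
    case False
    then obtain u where u: "u \<in> X" by auto
    define A where "A = {x \<in> X. x \<noteq> u \<and> (u, x) \<notin> E}"
    define B where "B = {x \<in> X. x \<noteq> u \<and> (u, x) \<in> E}"
    have "clique E A"
      unfolding clique_def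
    proof (intro ballI impI)
      fix x y assume "x \<in> A" "y \<in> A" "x \<noteq> y"
      then show "(x, y) \<in> E" using sub[of u x y] u by (auto simp: A_def)
    qed
    then have A: "card A \<le> Suc k" by (intro cl) (auto simp: A_def)
    have "2 * card B \<le> k * (k + 3)"
    proof (rule Suc.IH)
      show "finite B" using fin by (simp add: B_def)
      show "sym E" by fact
      show "(a, b) \<in> E \<or> (a, c) \<in> E \<or> (b, c) \<in> E"
        if "{a, b, c} \<subseteq> B" "distinct [a, b, c]" for a b c
        using that by (intro sub) (auto simp: B_def)
      fix C assume C: "C \<subseteq> B" "clique E C"
      then have "card (insert u C) \<le> Suc k"
        using u \<open>sym E\<close> by (intro cl) (auto simp: B_def clique_def dest: symD)
      moreover have "finite C" "u \<notin> C"
        using C(1) fin finite_subset[of C X] by (auto simp: B_def)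
      ultimately show "card C \<le> k" by simp
    qed
    moreover have "card X \<le> 1 + (card A + card B)"
    proof -
      have "X = insert u (A \<union> B)" using u by (auto simp: A_def B_def)
      moreover have "card (insert u (A \<union> B)) \<le> Suc (card (A \<union> B))"
        by (rule card_insert_le_m1) simp_all
      ultimately show ?thesis using card_Un_le[of A B] by simp
    qed
    ultimately show ?thesis using A by (simp add: algebra_simps)
  qed simp
qed

text \<open>The graph as a bare relation, with claw-freeness and the clique number in elementary
  form; \<open>claw_free_clique_bounded_pair_graph\<close> derives these from the digraph
  notions.\<close>

locale claw_free_clique_bounded =
  fixes V :: "'a set" and E :: "'a rel" and \<omega> :: nat
  assumes finite_V: "finite V" and E_subset: "E \<subseteq> V \<times> V"
    and sym_E: "sym E" and irrefl_E: "irrefl E"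
    and claw: "\<And>v a b c. (v, a) \<in> E \<Longrightarrow> (v, b) \<in> E \<Longrightarrow> (v, c) \<in> E \<Longrightarrow> distinct [a, b, c] \<Longrightarrow>
                 (a, b) \<in> E \<or> (a, c) \<in> E \<or> (b, c) \<in> E"
    and card_clique: "\<And>C. C \<subseteq> V \<Longrightarrow> clique E C \<Longrightarrow> card C \<le> \<omega>"
begin

abbreviation nbrs :: "'a \<Rightarrow> 'a set" where
  "nbrs v \<equiv> E `` {v}"

definition second_nbrs :: "'a \<Rightarrow> 'a set" where
  "second_nbrs v = (E O E) `` {v} - nbrs v - {v}"

text \<open>By \<open>graph_squareD\<close> it contains all arcs of \<open>graph_square\<close>, so
  a colouring proper for \<open>square\<close> is proper there.\<close>

definition square :: "'a rel" where
  "square = (E \<union> E O E) - Id"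

definition splits :: "'a \<Rightarrow> 'a set \<Rightarrow> 'a set \<Rightarrow> bool" where
  "splits v K L \<longleftrightarrow> clique E K \<and> clique E L \<and> card K = \<omega> \<and> card L = \<omega> \<and>
     K \<inter> L = {v} \<and> K \<union> L = insert v (nbrs v) \<and> (\<forall>x\<in>K - {v}. \<forall>y\<in>L - {v}. (x, y) \<notin> E)"

lemma E_sym: "(x, y) \<in> E \<Longrightarrow> (y, x) \<in> E"
  using sym_E by (auto dest: symD)

lemma E_irrefl [simp]: "(x, x) \<notin> E"
  using irrefl_E by (auto simp: irrefl_def)

lemma E_V: "(x, y) \<in> E \<Longrightarrow> x \<in> V \<and> y \<in> V"
  using E_subset by auto

lemma finite_nbrs [simp]: "finite (nbrs v)"
  by (rule finite_subset[OF _ finite_V]) (auto dest: E_V)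

lemma finite_second_nbrs [simp]: "finite (second_nbrs v)"
  by (rule finite_subset[OF _ finite_V]) (auto simp: second_nbrs_def dest: E_V)

section \<open>Counting second neighbours\<close>

lemma square_nbrs: "square `` {v} = nbrs v \<union> second_nbrs v"
  by (auto simp: square_def second_nbrs_def)

lemma card_square_nbrs_le: "card (square `` {v}) \<le> card (nbrs v) + card (second_nbrs v)"
  unfolding square_nbrs by (rule card_Un_le)

text \<open>Adding \<open>v\<close> to \<open>C\<close> gives a clique with one more vertex.\<close>

lemma card_clique_nbrs:
  assumes "v \<in> V" "C \<subseteq> nbrs v" "clique E C"
  shows "card C \<le> \<omega> - 1"
proof -
  have "clique E (insert v C)"
    using assms(2,3) by (auto simp: clique_def intro: E_sym)
  then have "card (insert v C) \<le> \<omega>"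
    using assms(1,2) by (intro card_clique) (auto dest: E_V)
  moreover have "finite C" "v \<notin> C" using assms(2) by (auto intro: finite_subset)
  ultimately show ?thesis by simp
qed

text \<open>By claw-freeness at \<open>u\<close>, with \<open>v\<close> as one of the three leaves.\<close>

lemma card_nbrs_Int_second_nbrs:
  assumes "(v, u) \<in> E"
  shows "card (nbrs u \<inter> second_nbrs v) \<le> \<omega> - 1"
proof (rule card_clique_nbrs)
  show "u \<in> V" using assms E_V by blast
  show "clique E (nbrs u \<inter> second_nbrs v)"
    unfolding clique_def
  proof (intro ballI impI)
    fix x y assume "x \<in> nbrs u \<inter> second_nbrs v" "y \<in> nbrs u \<inter> second_nbrs v" "x \<noteq> y"
    then show "(x, y) \<in> E"
      using claw[of u v x y] E_sym[OF assms] by (auto simp: second_nbrs_def)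
  qed
qed simp

text \<open>Union bound over a set \<open>D\<close> of neighbours that reaches all second
  neighbours. Each neighbour that can be left out of \<open>D\<close> saves \<omega> - 1.\<close>

lemma card_second_nbrs_le:
  assumes "D \<subseteq> nbrs v" "\<And>x. x \<in> second_nbrs v \<Longrightarrow> \<exists>u\<in>D. (u, x) \<in> E"
  shows "card (second_nbrs v) \<le> card D * (\<omega> - 1)"
proof -
  have fin: "finite D" using assms(1) by (rule finite_subset) simp
  have "second_nbrs v \<subseteq> (\<Union>u\<in>D. nbrs u \<inter> second_nbrs v)" using assms(2) by auto
  then have "card (second_nbrs v) \<le> card (\<Union>u\<in>D. nbrs u \<inter> second_nbrs v)"
    using fin by (intro card_mono) auto
  also have "\<dots> \<le> (\<Sum>u\<in>D. card (nbrs u \<inter> second_nbrs v))"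
    by (rule card_UN_le[OF fin])
  also have "\<dots> \<le> (\<Sum>u\<in>D. \<omega> - 1)"
    using assms(1) by (intro sum_mono card_nbrs_Int_second_nbrs) auto
  finally show ?thesis by simp
qed

lemma second_nbrsE:
  assumes "x \<in> second_nbrs v"
  obtains u where "(v, u) \<in> E" "(u, x) \<in> E" "(v, x) \<notin> E" "x \<noteq> v"
  using assms by (auto simp: second_nbrs_def)

text \<open>Every second neighbour reached from an endpoint of a cross edge is reached a second time.\<close>

lemma card_second_nbrs_cross_edge:
  assumes A: "a \<in> A" "clique E A" "card A = \<omega> - 1"
    and nbrs: "A \<union> B = nbrs v" "A \<inter> B = {}"
    and b: "b \<in> B" "(a, b) \<in> E"
  shows "card (second_nbrs v) \<le> (card (nbrs v) - 1) * (\<omega> - 1)"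
proof -
  have va: "(v, a) \<in> E" and vb: "(v, b) \<in> E" using A(1) b(1) nbrs(1) by auto
  \<comment> \<open>Otherwise \<open>b\<close> would extend \<open>A\<close> to a clique of \<omega>
    vertices in the neighbourhood of \<open>v\<close>.\<close>
  have "\<exists>a'\<in>A. (a', b) \<notin> E"
  proof (rule ccontr)
    assume "\<not> ?thesis"
    then have "clique E (insert b A)"
      using A(2) by (auto simp: clique_def intro: E_sym)
    then have "card (insert b A) \<le> \<omega> - 1"
      using nbrs(1) b(1) va E_V by (intro card_clique_nbrs[of v]) auto
    moreover have "finite A" "b \<notin> A"
      using nbrs b(1) by (auto intro: finite_subset[of A "nbrs v"])
    ultimately show False using A(3) by simp
  qed
  then obtain a' where a': "a' \<in> A" "(a', b) \<notin> E" by auto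
  have "card (second_nbrs v) \<le> card (nbrs v - {a}) * (\<omega> - 1)"
  proof (rule card_second_nbrs_le)
    fix x assume "x \<in> second_nbrs v"
    then obtain u where u: "(v, u) \<in> E" "(u, x) \<in> E" "(v, x) \<notin> E" by (rule second_nbrsE)
    show "\<exists>u\<in>nbrs v - {a}. (u, x) \<in> E"
    proof (cases "u = a")
      case False
      then show ?thesis using u by auto
    next
      case True
      have "a' \<noteq> a" using a' b by auto
      then have "(a, a') \<in> E" using A(1,2) a'(1) by (auto simp: clique_def)
      moreover have "(v, a') \<in> E" using a'(1) nbrs(1) by auto
      moreover have "a' \<noteq> b" using a'(1) b(1) nbrs(2) by auto
      ultimately have "(a', x) \<in> E \<or> (b, x) \<in> E"
        using claw[of a a' b x] a'(2) b(2) u True vb by auto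
      moreover have "b \<noteq> a" using b by auto
      ultimately show ?thesis using \<open>(v, a') \<in> E\<close> vb \<open>a' \<noteq> a\<close> by auto
    qed
  qed auto
  then show ?thesis using va by simp
qed

text \<open>Claw-freeness at \<open>v\<close>, with \<open>u\<close> as one of the leaves.\<close>

lemma clique_non_nbrs:
  assumes "(v, u) \<in> E"
  shows "clique E (nbrs v - nbrs u - {u})"
  unfolding clique_def
proof (intro ballI impI)
  fix x y assume "x \<in> nbrs v - nbrs u - {u}" "y \<in> nbrs v - nbrs u - {u}" "x \<noteq> y"
  then show "(x, y) \<in> E" using claw[of v u x y] assms by auto
qed

text \<open>
  Here no neighbour \<open>u\<close> yields a cover of the neighbourhood by two cliques. The set \<open>S\<close> of common
  neighbours of \<open>v\<close> and a second neighbour then has at least two elements and misses at most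
  \<open>2\<omega> - 3\<close> neighbours of \<open>v\<close>.
\<close>

lemma card_second_nbrs_no_clique_cover:
  assumes "\<omega> \<ge> 3" and nc: "\<And>u. (v, u) \<in> E \<Longrightarrow> \<not> clique E (nbrs u \<inter> nbrs v)"
  shows "2 * card (second_nbrs v) \<le> (2 * \<omega> - 1) * (\<omega> - 1)"
proof -
  define d where "d = card (nbrs v)"
  \<comment> \<open>Lower bound for the number of common neighbours. The subtraction is truncated,
    so for small \<open>d\<close> the value is 2.\<close>
  define s where "s = max 2 (d + 3 - 2 * \<omega>)"
  define n where "n = card (second_nbrs v)"
  have S: "s \<le> card {u \<in> nbrs v. (u, x) \<in> E}" if x: "x \<in> second_nbrs v" for x
  proof -
    define S where "S = {u \<in> nbrs v. (u, x) \<in> E}"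
    obtain u where u: "(v, u) \<in> E" "(u, x) \<in> E" "(v, x) \<notin> E"
      using x by (rule second_nbrsE)
    have finS: "finite S" by (rule finite_subset[of S "nbrs v"]) (auto simp: S_def)
    have vu: "v \<in> V" "u \<in> V" using u(1) E_V by auto
    \<comment> \<open>Claw-freeness at \<open>u\<close> with leaves \<open>w\<close>,
      \<open>w'\<close>, \<open>x\<close>. It gives a second element \<open>z\<close> of
      \<open>S\<close> besides \<open>u\<close>, and it makes the common neighbours outside
      \<open>S\<close> a clique.\<close>
    have key: "w \<in> S \<or> w' \<in> S"
      if "w \<in> nbrs u \<inter> nbrs v" "w' \<in> nbrs u \<inter> nbrs v" "w \<noteq> w'" "(w, w') \<notin> E" for w w'
      using claw[of u w w' x] that u by (auto simp: S_def)
    obtain w w' where w: "w \<in> nbrs u \<inter> nbrs v" "w' \<in> nbrs u \<inter> nbrs v" "w \<noteq> w'" "(w, w') \<notin> E"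
      using nc[OF u(1)] by (auto simp: clique_def)
    then obtain z where z: "z \<in> S" "z \<in> nbrs u" using key by blast
    have "{u, z} \<subseteq> S" "u \<noteq> z" using u z by (auto simp: S_def)
    then have two: "2 \<le> card S"
      using card_mono[OF finS, of "{u, z}"] by simp
    have c1: "card (nbrs u \<inter> nbrs v - S) \<le> \<omega> - 2"
    proof -
      define C where "C = nbrs u \<inter> nbrs v - S"
      have "clique E C" unfolding clique_def C_def using key by blast
      then have "clique E (insert u C)"
        by (auto simp: clique_def C_def intro: E_sym)
      then have "card (insert u C) \<le> \<omega> - 1"
        using u vu by (intro card_clique_nbrs[of v]) (auto simp: C_def)
      moreover have "finite C" "u \<notin> C" by (auto simp: C_def)
      ultimately show ?thesis by (simp add: C_def)
    qed
    have c2: "card (nbrs v - nbrs u - {u}) \<le> \<omega> - 1"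
      using clique_non_nbrs[OF u(1)] vu by (intro card_clique_nbrs[of v]) auto
    \<comment> \<open>The neighbours outside \<open>S\<close> fall into two cliques, of at most
      \<omega> - 2 and \<omega> - 1 vertices: this is the 2\<omega> - 3 in \<open>s\<close>.\<close>
    have "nbrs v \<subseteq> S \<union> ((nbrs u \<inter> nbrs v - S) \<union> (nbrs v - nbrs u - {u}))"
      using u by (auto simp: S_def)
    then have "d \<le> card (S \<union> ((nbrs u \<inter> nbrs v - S) \<union> (nbrs v - nbrs u - {u})))"
      unfolding d_def using finS by (intro card_mono) auto
    also have "\<dots> \<le> card S + (card (nbrs u \<inter> nbrs v - S) + card (nbrs v - nbrs u - {u}))"
      by (meson add_left_mono card_Un_le le_trans)
    finally show ?thesis using c1 c2 two assms(1) by (auto simp: s_def S_def)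
  qed
  \<comment> \<open>Double counting of the edges between the neighbours and the second neighbours of
    \<open>v\<close>.\<close>
  have "n * s \<le> (\<Sum>x\<in>second_nbrs v. card {u \<in> nbrs v. (u, x) \<in> E})"
    unfolding n_def using S by (rule sum_bounded_below[of _ s, simplified])
  also have "\<dots> = (\<Sum>u\<in>nbrs v. card {x \<in> second_nbrs v. (u, x) \<in> E})"
    by (rule sum_multicount_gen[symmetric]) auto
  also have "\<dots> \<le> (\<Sum>u\<in>nbrs v. \<omega> - 1)"
  proof (rule sum_mono)
    fix u assume "u \<in> nbrs v"
    moreover have "{x \<in> second_nbrs v. (u, x) \<in> E} = nbrs u \<inter> second_nbrs v" by auto
    ultimately show "card {x \<in> second_nbrs v. (u, x) \<in> E} \<le> \<omega> - 1"
      using card_nbrs_Int_second_nbrs by simp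
  qed
  also have "\<dots> = d * (\<omega> - 1)" by (simp add: d_def)
  also have "\<dots> \<le> (s + (2 * \<omega> - 3)) * (\<omega> - 1)"
    using assms(1) by (intro mult_right_mono) (auto simp: s_def)
  finally have le: "n * s \<le> s * (\<omega> - 1) + (2 * \<omega> - 3) * (\<omega> - 1)"
    by (simp add: algebra_simps)
  have "2 * n \<le> (2 * \<omega> - 1) * (\<omega> - 1)"
  proof (cases "n \<le> \<omega> - 1")
    case True
    have "2 * n \<le> (2 * \<omega> - 1) * n" using assms(1) by (intro mult_right_mono) auto
    also have "\<dots> \<le> (2 * \<omega> - 1) * (\<omega> - 1)" using True by (intro mult_left_mono) auto
    finally show ?thesis .
  next
    case False
    \<comment> \<open>Only the excess \<open>t\<close> of \<open>n\<close> over \<omega> - 1 has to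
      be compared with the second summand of \<open>le\<close>; there \<open>s\<close> may be
      replaced by its lower bound 2.\<close>
    then obtain t where t: "n = (\<omega> - 1) + t" by (metis le_add_diff_inverse nat_le_linear)
    have "2 * t \<le> s * t" by (intro mult_right_mono) (auto simp: s_def)
    also have "\<dots> \<le> (2 * \<omega> - 3) * (\<omega> - 1)" using le by (simp add: t algebra_simps)
    finally have "2 * n \<le> 2 * (\<omega> - 1) + (2 * \<omega> - 3) * (\<omega> - 1)" by (simp add: t)
    also have "\<dots> = (2 + (2 * \<omega> - 3)) * (\<omega> - 1)" by (simp only: add_mult_distrib)
    also have "2 + (2 * \<omega> - 3) = 2 * \<omega> - 1" using assms(1) by simp
    finally show ?thesis .
  qed
  then show ?thesis by (simp add: n_def)
qed

text \<open>Three cases. If d \<le> 2\<omega> - 3, the union bound over all neighbours suffices. If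
  two cliques cover the neighbourhood of larger size, then d = 2\<omega> - 2, and a cross edge
  exists because \<open>v\<close> is not split. Otherwise the Ramsey bound controls \<open>d\<close>
  and double counting controls \<open>n\<close>.\<close>

lemma card_square_nbrs_not_split:
  assumes "\<omega> \<ge> 5" "v \<in> V" "\<nexists>K L. splits v K L"
  shows "card (square `` {v}) + 4 \<le> 2 * \<omega> * (\<omega> - 1)"
proof -
  define d where "d = card (nbrs v)"
  define n where "n = card (second_nbrs v)"
  \<comment> \<open>Writing \<omega> as \<open>m + 5\<close> removes the truncated subtractions from
    the final estimates.\<close>
  obtain m where m: "\<omega> = m + 5" using assms(1) by (metis add.commute le_Suc_ex)
  have "d + n + 4 \<le> 2 * \<omega> * (\<omega> - 1)"
  proof (cases "d \<le> 2 * \<omega> - 3")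
    case True
    have "n \<le> d * (\<omega> - 1)"
      unfolding n_def d_def by (rule card_second_nbrs_le) (auto elim: second_nbrsE)
    also have "\<dots> \<le> (2 * \<omega> - 3) * (\<omega> - 1)" using True by (rule mult_right_mono) simp
    finally show ?thesis using True by (simp add: m algebra_simps)
  next
    case d_large: False
    show ?thesis
    proof (cases "\<exists>u. (v, u) \<in> E \<and> clique E (nbrs u \<inter> nbrs v)")
      case True
      then obtain u where u: "(v, u) \<in> E" "clique E (nbrs u \<inter> nbrs v)" by auto
      define A where "A = insert u (nbrs u \<inter> nbrs v)"
      define B where "B = nbrs v - nbrs u - {u}"
      have AB: "A \<union> B = nbrs v" "A \<inter> B = {}" using u by (auto simp: A_def B_def)
      have clA: "clique E A" using u(2) by (auto simp: A_def clique_def intro: E_sym)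
      have clB: "clique E B" unfolding B_def using u(1) by (rule clique_non_nbrs)
      have fin: "finite A" "finite B" by (auto simp: A_def B_def)
      have "d = card A + card B"
        unfolding d_def AB(1)[symmetric] using fin AB(2) by (rule card_Un_disjoint)
      moreover have "card A \<le> \<omega> - 1" "card B \<le> \<omega> - 1"
        using AB(1) clA clB assms(2) by (blast intro: card_clique_nbrs[of v])+
      \<comment> \<open>Two cliques of at most \<omega> - 1 vertices with more than 2\<omega> - 3 in
        total: both must have full size.\<close>
      ultimately have card: "card A = \<omega> - 1" "card B = \<omega> - 1" "d = 2 * \<omega> - 2"
        using d_large assms(1) by auto
      have "\<exists>a\<in>A. \<exists>b\<in>B. (a, b) \<in> E"
      proof (rule ccontr)
        assume none: "\<not> ?thesis"
        have v: "v \<notin> A" "v \<notin> B" using AB(1) E_irrefl by blast+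
        have "splits v (insert v A) (insert v B)"
          unfolding splits_def
        proof (intro conjI)
          show "clique E (insert v A)" "clique E (insert v B)"
            using clA clB AB(1) by (auto simp: clique_def intro: E_sym)
          show "card (insert v A) = \<omega>" "card (insert v B) = \<omega>"
            using fin v card assms(1) by auto
        qed (use AB none v in auto)
        then show False using assms(3) by blast
      qed
      then obtain a b where "a \<in> A" "b \<in> B" "(a, b) \<in> E" by auto
      then have "n \<le> (d - 1) * (\<omega> - 1)"
        unfolding n_def d_def using clA card(1) assms(1) AB
        by (intro card_second_nbrs_cross_edge) auto
      \<comment> \<open>Here \<open>d + n\<close> is at most (2\<omega> - 1)(\<omega> - 1), which is
        \<omega> - 1 below 2\<omega>(\<omega> - 1); \<omega> \<ge> 5 makes this gap at least
        4.\<close>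
      then show ?thesis by (simp add: card(3) m algebra_simps)
    next
      case False
      then have "2 * n \<le> (2 * \<omega> - 1) * (\<omega> - 1)"
        unfolding n_def using assms(1) by (intro card_second_nbrs_no_clique_cover) auto
      \<comment> \<open>Claw-freeness at \<open>v\<close> excludes three independent neighbours, and
        cliques among the neighbours have at most \<omega> - 1 vertices.\<close>
      moreover have "2 * d \<le> (\<omega> - 1) * (\<omega> - 1 + 3)"
        unfolding d_def
      proof (rule ramsey_three_bound[OF _ sym_E])
        show "(a, b) \<in> E \<or> (a, c) \<in> E \<or> (b, c) \<in> E"
          if "{a, b, c} \<subseteq> nbrs v" "distinct [a, b, c]" for a b c
          using that by (intro claw[of v]) auto
      qed (use assms(2) card_clique_nbrs in auto)
      ultimately show ?thesis by (simp add: m algebra_simps)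
    qed
  qed
  then show ?thesis using card_square_nbrs_le[of v] by (simp add: d_def n_def)
qed

section \<open>The intersection graph of the split cliques\<close>

lemma splits_commute:
  assumes "splits v K L"
  shows "splits v L K"
proof -
  have "(x, y) \<notin> E" if "x \<in> L - {v}" "y \<in> K - {v}" for x y
    using assms that E_sym[of x y] unfolding splits_def by blast
  then show ?thesis using assms by (simp add: splits_def Int_commute Un_commute)
qed

text \<open>\<open>C\<close> lies in the closed neighbourhood of \<open>v\<close>, so leaving both
  \<open>K\<close> and \<open>L\<close> would require an edge between \<open>K - {v}\<close> and
  \<open>L - {v}\<close>.\<close>

lemma splits_clique_subset:
  assumes "splits v K L" "clique E C" "v \<in> C"
  shows "C \<subseteq> K \<or> C \<subseteq> L"
proof (rule ccontr)
  assume "\<not> ?thesis"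
  then obtain x y where xy: "x \<in> C" "x \<notin> K" "y \<in> C" "y \<notin> L" by auto
  have "C \<subseteq> insert v (nbrs v)" using assms(2,3) by (auto simp: clique_def)
  then have "C \<subseteq> K \<union> L" using assms(1) by (simp add: splits_def)
  moreover have "v \<in> K" "v \<in> L" using assms(1) by (auto simp: splits_def)
  ultimately have "y \<in> K - {v}" "x \<in> L - {v}" using xy by auto
  then have "(y, x) \<notin> E" using assms(1) by (auto simp: splits_def)
  moreover have "(y, x) \<in> E" using xy assms(2) \<open>y \<in> K - {v}\<close> by (auto simp: clique_def)
  ultimately show False by simp
qed

text \<open>\<open>splits\<close> does not itself place \<open>v\<close> in \<open>V\<close>; with
  \<omega> \<ge> 2, \<open>K\<close> contains a neighbour of \<open>v\<close>, and its edge to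
  \<open>v\<close> does.\<close>

lemma splits_subset_V:
  assumes "splits v K L" "\<omega> \<ge> 2"
  shows "K \<subseteq> V"
proof -
  have K: "K \<subseteq> insert v (nbrs v)" and card: "card K = \<omega>"
    using assms by (auto simp: splits_def)
  have "\<not> K \<subseteq> {v}"
    using card assms(2) card_mono[of "{v}" K] by auto
  then have "v \<in> V" using K E_V by fastforce
  then show ?thesis using K E_V by auto
qed

lemma splits_clique_eq:
  assumes "splits v K L" "clique E C" "v \<in> C" "card C = \<omega>"
  shows "C = K \<or> C = L"
proof -
  have "finite (K \<union> L)" "card K = \<omega>" "card L = \<omega>"
    using assms(1) by (auto simp: splits_def)
  then show ?thesis
    using splits_clique_subset[OF assms(1-3)] assms(4)
    by (metis card_subset_eq finite_Un)
qed

definition split_cliques :: "'a set set" where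
  "split_cliques = {K. \<exists>v L. splits v K L}"

text \<open>The clique \<open>{v, v', w}\<close> is not inside \<open>L\<close>, as \<open>w\<close>
  is not in \<open>L\<close>, so it lies in \<open>K\<close>. Then \<open>K\<close> is an
  \<omega>-clique through \<open>v'\<close>, hence \<open>K'\<close> or \<open>L'\<close>, and
  \<open>w\<close> excludes \<open>L'\<close>.\<close>

lemma split_cliques_eq:
  assumes s: "splits v K L" "splits v' K' L'"
    and w: "w \<in> K" "w \<in> K'" "w \<noteq> v" "w \<noteq> v'"
    and vv': "v = v' \<or> (v, v') \<in> E"
  shows "K = K'"
proof -
  have mem: "v \<in> K" "v' \<in> K'" and cl: "clique E K" "clique E K'" "card K = \<omega>"
    and notin: "w \<notin> L" "w \<notin> L'"
    using s w by (auto simp: splits_def)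
  have "clique E {v, v', w}"
    using w vv' mem cl by (auto simp: clique_def intro: E_sym)
  then have "{v, v', w} \<subseteq> K"
    using splits_clique_subset[OF s(1), of "{v, v', w}"] notin by auto
  then show ?thesis
    using splits_clique_eq[OF s(2) cl(1)] cl(3) notin w(1) by auto
qed

text \<open>If \<open>w\<close> is split, its own two cliques are the only candidates. Otherwise
  three different cliques would, by \<open>split_cliques_eq\<close>, have distinct and pairwise
  non-adjacent split vertices \<open>v1\<close>, \<open>v2\<close>, \<open>v3\<close>, which form a
  claw centred at \<open>w\<close>.\<close>

lemma at_most_two_split_cliques:
  assumes "K1 \<in> split_cliques" "K2 \<in> split_cliques" "K3 \<in> split_cliques"
    and w: "w \<in> K1" "w \<in> K2" "w \<in> K3"
  shows "K1 = K2 \<or> K1 = K3 \<or> K2 = K3"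
proof -
  obtain v1 L1 v2 L2 v3 L3
    where s: "splits v1 K1 L1" "splits v2 K2 L2" "splits v3 K3 L3"
    using assms(1-3) by (auto simp: split_cliques_def)
  then have cl: "clique E K1" "clique E K2" "clique E K3"
    and card: "card K1 = \<omega>" "card K2 = \<omega>" "card K3 = \<omega>"
    and mem: "v1 \<in> K1" "v2 \<in> K2" "v3 \<in> K3"
    by (auto simp: splits_def)
  show ?thesis
  proof (cases "\<exists>K L. splits w K L")
    case True
    then obtain K L where "splits w K L" by auto
    then have "C = K \<or> C = L" if "C \<in> {K1, K2, K3}" for C
      using that splits_clique_eq[of w K L C] w cl card by auto
    then show ?thesis by blast
  next
    case False
    then have ne: "w \<noteq> v1" "w \<noteq> v2" "w \<noteq> v3" using s by auto
    show ?thesis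
    proof (rule ccontr)
      assume "\<not> ?thesis"
      then have "\<not> (v1 = v2 \<or> (v1, v2) \<in> E)" "\<not> (v1 = v3 \<or> (v1, v3) \<in> E)"
        "\<not> (v2 = v3 \<or> (v2, v3) \<in> E)"
        using split_cliques_eq[OF s(1,2) w(1,2) ne(1,2)] split_cliques_eq[OF s(1,3) w(1,3) ne(1,3)]
          split_cliques_eq[OF s(2,3) w(2,3) ne(2,3)] by auto
      moreover have "(w, v1) \<in> E" "(w, v2) \<in> E" "(w, v3) \<in> E"
        using cl mem w ne by (auto simp: clique_def)
      ultimately show False using claw[of w v1 v2 v3] by auto
    qed
  qed
qed

section \<open>The intersection graph \<open>meets\<close> and its degrees\<close>

definition meets :: "'a set rel" where
  "meets = {(K, K'). K \<in> split_cliques \<and> K' \<in> split_cliques \<and> K \<noteq> K' \<and> K \<inter> K' \<noteq> {}}"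

lemma finite_meets:
  assumes "\<omega> \<ge> 2"
  shows "finite meets"
proof -
  have "meets \<subseteq> Pow V \<times> Pow V"
    using splits_subset_V[OF _ assms] by (fastforce simp: meets_def split_cliques_def)
  then show ?thesis using finite_V by (meson finite_Pow_iff finite_SigmaI finite_subset)
qed

text \<open>Choose a vertex of \<open>K\<close> in each clique that meets \<open>K\<close>. The
  choice is injective, since each vertex lies in at most one split clique besides
  \<open>K\<close>.\<close>

lemma card_meets_le: "card (meets `` {K}) \<le> \<omega>"
proof (cases "K \<in> split_cliques")
  case False
  then have "meets `` {K} = {}" by (auto simp: meets_def)
  then show ?thesis by simp
next
  case True
  then have K: "card K = \<omega>" "finite K"
    by (auto simp: split_cliques_def splits_def intro: finite_subset[of K "insert _ (nbrs _)"])
  define f where "f K' = (SOME w. w \<in> K \<inter> K')" for K'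
  have f: "f K' \<in> K \<inter> K'" if "K' \<in> meets `` {K}" for K'
    unfolding f_def by (rule someI_ex) (use that in \<open>auto simp: meets_def\<close>)
  have "inj_on f (meets `` {K})"
  proof (rule inj_onI)
    fix K1 K2 assume K12: "K1 \<in> meets `` {K}" "K2 \<in> meets `` {K}" "f K1 = f K2"
    then have "f K1 \<in> K" "f K1 \<in> K1" "f K1 \<in> K2" using f[of K1] f[of K2] by auto
    then show "K1 = K2"
      using at_most_two_split_cliques[of K K1 K2 "f K1"] K12 True by (auto simp: meets_def)
  qed
  moreover have "f ` (meets `` {K}) \<subseteq> K" using f by auto
  ultimately show ?thesis using card_inj_on_le[of f "meets `` {K}" K] K by simp
qed

text \<open>A split vertex thus becomes an edge of \<open>meets\<close>. \<omega> \<ge> 2 makes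
  \<open>K\<close> and \<open>L\<close> different, since they share a single vertex.\<close>

lemma splits_meets:
  assumes "splits v K L" "\<omega> \<ge> 2"
  shows "(K, L) \<in> meets"
proof -
  have "K \<noteq> L" using assms by (auto simp: splits_def)
  then show ?thesis
    using assms splits_commute[OF assms(1)] by (auto simp: meets_def split_cliques_def splits_def)
qed

section \<open>From a strong edge colouring to a colouring of the square\<close>

lemma square_colouring_split:
  assumes "\<omega> \<ge> 2"
  obtains k c where "enat k \<le> strong_chromatic_index_sup \<omega>"
    and "\<And>v K L. splits v K L \<Longrightarrow> c v < (k :: nat)"
    and "\<And>v K L v' K' L'. splits v K L \<Longrightarrow> splits v' K' L' \<Longrightarrow> (v, v') \<in> square \<Longrightarrow> c v \<noteq> c v'"
proof -
  have "sym meets" "irrefl meets" by (auto simp: meets_def sym_def irrefl_def)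
  then obtain k c where k: "enat k \<le> strong_chromatic_index_sup \<omega>"
    and c_less: "\<And>K L. (K, L) \<in> meets \<Longrightarrow> c {K, L} < (k :: nat)"
    and c: "\<And>x y x' y' a b. (x, y) \<in> meets \<Longrightarrow> (x', y') \<in> meets \<Longrightarrow> (a, b) \<in> meets \<Longrightarrow>
           {x, y} \<noteq> {x', y'} \<Longrightarrow> {x, y} \<inter> {a, b} \<noteq> {} \<Longrightarrow> {a, b} \<inter> {x', y'} \<noteq> {} \<Longrightarrow>
           c {x, y} \<noteq> c {x', y'}"
    using strong_edge_colouring[OF finite_meets[OF assms] _ _ card_meets_le] by blast
  \<comment> \<open>The edge of \<open>meets\<close> assigned to \<open>v\<close>, as an unordered
    pair; any choice serves.\<close>
  define e where "e v = (SOME e. \<exists>K L. splits v K L \<and> e = {K, L})" for v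
  have e: "\<exists>K L. splits v K L \<and> e v = {K, L}" if "splits v K L" for v K L
  proof -
    have "\<exists>K L. splits v K L \<and> e v = {K, L}"
      unfolding e_def by (rule someI_ex) (use that in blast)
    then show ?thesis .
  qed
  show thesis
  proof (rule that[OF k, of "\<lambda>v. c (e v)"])
    show "c (e v) < k" if "splits v K L" for v K L
      using e[OF that] splits_meets assms c_less by fastforce
  next
    fix v v' K0 L0 K0' L0'
    assume "splits v K0 L0" "splits v' K0' L0'" and sq: "(v, v') \<in> square"
    then obtain K L K' L' where s: "splits v K L" "splits v' K' L'"
      and ev: "e v = {K, L}" "e v' = {K', L'}"
      using e by meson
    have "v \<noteq> v'" using sq by (auto simp: square_def)
    \<comment> \<open>The vertex is recovered from its edge as the only element of
      \<open>K \<inter> L\<close>.\<close>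
    have ne: "{K, L} \<noteq> {K', L'}"
    proof
      assume "{K, L} = {K', L'}"
      then have "K \<inter> L = K' \<inter> L'" by (auto simp: doubleton_eq_iff)
      then show False using s \<open>v \<noteq> v'\<close> by (auto simp: splits_def)
    qed
    \<comment> \<open>Distance at most two means that the closed neighbourhoods intersect.\<close>
    have "\<exists>w. w \<in> K \<union> L \<and> w \<in> K' \<union> L'"
    proof -
      have "\<exists>w. w \<in> insert v (nbrs v) \<and> w \<in> insert v' (nbrs v')"
        using sq by (auto simp: square_def intro: E_sym)
      then show ?thesis using s by (simp add: splits_def)
    qed
    then obtain w P Q where w: "w \<in> P" "w \<in> Q" and PQ: "P \<in> {K, L}" "Q \<in> {K', L'}" by blast
    have m: "(K, L) \<in> meets" "(K', L') \<in> meets"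
      using s assms by (auto intro: splits_meets)
    then have "P \<in> split_cliques" "Q \<in> split_cliques"
      using PQ by (auto simp: meets_def)
    then have "P = Q \<or> (P, Q) \<in> meets" using w by (auto simp: meets_def)
    \<comment> \<open>If \<open>P = Q\<close>, the two edges already share an endpoint and
      \<open>{K, L}\<close> itself serves as the link; otherwise \<open>{P, Q}\<close> does.\<close>
    then have "\<exists>(a, b)\<in>meets. {K, L} \<inter> {a, b} \<noteq> {} \<and> {a, b} \<inter> {K', L'} \<noteq> {}"
    proof
      assume "P = Q"
      then show ?thesis using PQ m(1) by (intro bexI[of _ "(K, L)"]) auto
    next
      assume "(P, Q) \<in> meets"
      then show ?thesis using PQ by (intro bexI[of _ "(P, Q)"]) auto
    qed
    then show "c (e v) \<noteq> c (e v')"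
      unfolding ev using c[OF m _ ne] by blast
  qed
qed

lemma square_colouring:
  assumes "\<omega> \<ge> 5"
  obtains k c where "enat k \<le> max (strong_chromatic_index_sup \<omega>) (enat (2 * \<omega> * (\<omega> - 1) - 3))"
    and "c ` V \<subseteq> {..<k :: nat}" and "\<And>x y. x \<in> V \<Longrightarrow> y \<in> V \<Longrightarrow> (x, y) \<in> square \<Longrightarrow> c x \<noteq> c y"
proof -
  have "\<omega> \<ge> 2" using assms by simp
  then obtain k c where k: "enat k \<le> strong_chromatic_index_sup \<omega>"
    and c: "\<And>v K L. splits v K L \<Longrightarrow> c v < (k :: nat)"
      "\<And>v K L v' K' L'. splits v K L \<Longrightarrow> splits v' K' L' \<Longrightarrow> (v, v') \<in> square \<Longrightarrow> c v \<noteq> c v'"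
    by (rule square_colouring_split) blast
  define m where "m = max k (2 * \<omega> * (\<omega> - 1) - 3)"
  define A where "A = {v. \<exists>K L. splits v K L}"
  have "\<exists>c. c ` (A \<union> (V - A)) \<subseteq> {..<m} \<and>
    (\<forall>x\<in>A \<union> (V - A). \<forall>y\<in>A \<union> (V - A). (x, y) \<in> square \<longrightarrow> c x \<noteq> c y)"
  proof (rule greedy_colouring_extension)
    show "finite (V - A)" using finite_V by simp
    show "sym square" by (auto simp: square_def sym_def intro: E_sym)
    show "irrefl square" by (auto simp: square_def irrefl_def)
    \<comment> \<open>The degree plus 4 is at most 2\<omega>(\<omega> - 1), so it is strictly below
      the number 2\<omega>(\<omega> - 1) - 3 of colours available.\<close>
    show "finite (square `` {b}) \<and> card (square `` {b}) < m" if "b \<in> V - A" for b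
      using card_square_nbrs_not_split[OF assms, of b] that
      by (auto simp: A_def m_def square_nbrs)
    show "c ` A \<subseteq> {..<m}" using c(1) by (force simp: A_def m_def)
    show "\<forall>x\<in>A. \<forall>y\<in>A. (x, y) \<in> square \<longrightarrow> c x \<noteq> c y" using c(2) by (auto simp: A_def)
  qed
  then obtain c' where "c' ` V \<subseteq> {..<m}"
    "\<And>x y. x \<in> V \<Longrightarrow> y \<in> V \<Longrightarrow> (x, y) \<in> square \<Longrightarrow> c' x \<noteq> c' y"
    by (auto simp: image_subset_iff)
  moreover have "enat m \<le> max (strong_chromatic_index_sup \<omega>) (enat (2 * \<omega> * (\<omega> - 1) - 3))"
    using k by (cases "k \<le> 2 * \<omega> * (\<omega> - 1) - 3") (simp_all add: m_def le_max_iff_disj)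
  ultimately show thesis using that[of m c'] by simp
qed

end

section \<open>Simple graphs as symmetric arc relations\<close>

lemma claw_free_clique_bounded_pair_graph:
  assumes "pair_graph G" "claw_free G"
  shows "claw_free_clique_bounded (pverts G) (parcs G) (clique_number G)"
proof -
  interpret pair_graph G by fact
  show ?thesis
  proof
    show "finite (pverts G)" by (fact pair_finite_verts)
    show sub: "parcs G \<subseteq> pverts G \<times> pverts G" by (auto dest: in_arcsD1 in_arcsD2)
    show "sym (parcs G)" by (auto intro: symI arcs_symmetric)
    show irr: "irrefl (parcs G)" by (auto simp: irrefl_def dest: no_loops')
    show "(a, b) \<in> parcs G \<or> (a, c) \<in> parcs G \<or> (b, c) \<in> parcs G"
      if va: "(v, a) \<in> parcs G" and vb: "(v, b) \<in> parcs G" and vc: "(v, c) \<in> parcs G"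
        and d: "distinct [a, b, c]" for v a b c
    proof (rule ccontr)
      assume n: "\<not> ?thesis"
      have n': "(b, a) \<notin> parcs G" "(c, a) \<notin> parcs G" "(c, b) \<notin> parcs G"
        using n arcs_symmetric by blast+
      have v: "v \<noteq> a" "v \<noteq> b" "v \<noteq> c" using va vb vc no_loops' by auto
      define H where "H = \<lparr>pverts = {v, a, b, c},
        parcs = {v} \<times> {a, b, c} \<union> {a, b, c} \<times> {v}\<rparr>"
      have "K\<^bsub>1,3\<^esub> (with_proj H)"
        unfolding complete_bipartite_digraph_pair_def
        using v d by (intro conjI exI[of _ "{v}"] exI[of _ "{a, b, c}"]) (auto simp: H_def)
      moreover have "induced_subgraph (with_proj H) (with_proj G)"
      proof
        have "graph (with_proj H)"
          using \<open>K\<^bsub>1,3\<^esub> (with_proj H)\<close> by (simp add: complete_bipartite_digraph_def)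
        then interpret H: graph "with_proj H" .
        have "wf_digraph (with_proj G)" "wf_digraph (with_proj H)" by unfold_locales
        then show "subgraph (with_proj H) (with_proj G)"
          using va vb vc sub arcs_symmetric
          unfolding subgraph_def by (auto simp: H_def compatible_def)
        show "arcs (with_proj H) =
          {e \<in> arcs (with_proj G). tail (with_proj G) e \<in> verts (with_proj H) \<and>
                                  head (with_proj G) e \<in> verts (with_proj H)}"
        proof -
          \<comment> \<open>\<open>n\<close> and \<open>n'\<close> exclude arcs between leaves and
            \<open>irr\<close> excludes loops: the star is induced.\<close>
          have "(x, y) \<in> parcs H \<longleftrightarrow> (x, y) \<in> parcs G \<and> x \<in> pverts H \<and> y \<in> pverts H" for x y
            using n n' v irr
            by (auto simp: H_def irrefl_def va vb vc va[THEN arcs_symmetric]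
                vb[THEN arcs_symmetric] vc[THEN arcs_symmetric])
          then show ?thesis by auto
        qed
      qed
      ultimately show False using assms(2) by (auto simp: claw_free_def)
    qed
    show "card C \<le> clique_number G" if C: "C \<subseteq> pverts G" "clique (parcs G) C" for C
    proof -
      define S where "S = {n. \<exists>H :: 'a pair_pre_digraph. subgraph (with_proj H) (with_proj G) \<and>
               K\<^bsub>n\<^esub> (with_proj H)}"
      \<comment> \<open>\<open>Max\<close> bounds its elements only for a finite set.\<close>
      have "S \<subseteq> {..card (pverts G)}"
        using pair_finite_verts by (auto simp: S_def complete_digraph_def subgraph_def intro!: card_mono)
      then have "finite S" by (rule finite_subset) simp
      moreover have "card C \<in> S"
      proof -
        define H where "H = \<lparr>pverts = C, parcs = {(u, v). (u, v) \<in> C \<times> C \<and> u \<noteq> v}\<rparr>"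
        have "finite C" using C(1) pair_finite_verts by (rule finite_subset)
        then have K: "K\<^bsub>card C\<^esub> (with_proj H)"
          unfolding complete_digraph_pair_def by (simp add: H_def)
        then interpret H: graph "with_proj H" by (simp add: complete_digraph_def)
        have "wf_digraph (with_proj G)" "wf_digraph (with_proj H)" by unfold_locales
        then have "subgraph (with_proj H) (with_proj G)"
          unfolding subgraph_def using C by (auto simp: H_def compatible_def clique_def)
        then show ?thesis using K by (auto simp: S_def)
      qed
      ultimately show ?thesis unfolding clique_number_def S_def[symmetric] by simp
    qed
  qed
qed

theorem theorem1p3:
  fixes \<omega> :: nat and G :: "'a pair_pre_digraph"
  assumes "\<omega> \<ge> 5"
    and "pair_graph G"
    and "claw_free G"
    and "clique_number G = \<omega>"
  shows "enat (chromatic_number (graph_square G))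
           \<le> max (strong_chromatic_index_sup \<omega>) (enat (2 * \<omega> * (\<omega> - 1) - 3))"
proof -
  interpret claw_free_clique_bounded "pverts G" "parcs G" \<omega>
    using claw_free_clique_bounded_pair_graph[OF assms(2,3)] assms(4) by simp
  obtain k c where k: "enat k \<le> max (strong_chromatic_index_sup \<omega>) (enat (2 * \<omega> * (\<omega> - 1) - 3))"
    and c: "c ` pverts G \<subseteq> {..<k :: nat}"
      "\<And>x y. x \<in> pverts G \<Longrightarrow> y \<in> pverts G \<Longrightarrow> (x, y) \<in> square \<Longrightarrow> c x \<noteq> c y"
    using square_colouring[OF assms(1)] by metis
  have "c x \<noteq> c y" if "(x, y) \<in> parcs (graph_square G)" for x y
  proof (rule c(2))
    show "x \<in> pverts G" "y \<in> pverts G" using that by (auto simp: graph_square_def)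
    show "(x, y) \<in> square"
      using graph_squareD[OF assms(2) that] by (auto simp: square_def)
  qed
  then have "proper_colouring (graph_square G) k c"
    using c(1) by (auto simp: proper_colouring_def graph_square_def)
  then have "chromatic_number (graph_square G) \<le> k" by (rule chromatic_number_le)
  then show ?thesis using k by (meson enat_ord_simps(1) order_trans)
qed

end
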